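(* Suppose each $f_i:\mathbb{R}^d\to\mathbb{R}$, $i=1,\dots,n$, is $L$-smooth, i.e. $\|\nabla f_i(x)-\nabla f_i(y)\|\le L\|x-y\|$ for any $x,y\in\mathbb{R}^d$, and suppose the network topology is strongly connected and its weight matrix $W\in\mathbb{R}^{n\times n}$ is symmetric and satisfies $W\mathbf 1=\mathbf 1$. If each $f_i$ is further assumed to be strongly convex, and the full-batch gradient $\nabla f_i(x)$ is accessed per iteration, then DmSGD (decentralized momentum SGD) with learning rate $\gamma$ and momentum coefficient $\beta\in(0,1)$ has the following inconsistency bias: $$\lim_{k\to\infty}\sum_{i=1}^n\|x_i^{(k)}-x^\star\|^2=O\Big(\frac{\gamma^2b^2}{(1-\beta)^2(1-\rho)^2}\Big),$$ where $b^2=\frac1n\sum_{i=1}^n\|\nabla f_i(x^\star)\|^2$ denotes the data inconsistency between nodes, $x^\star$ is the global minimizer of $f(x)=\frac1n\sum_{i=1}^n f_i(x)$, and $\rho=\max\{|\lambda_2(W)|,|\lambda_n(W)|\}$.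
   Context: Network and weights: $n$ nodes are connected by an undirected topology. $W=[w_{ij}]$ with $w_{ij}>0$ if node $j$ is connected to node $i$ or $i=j$, and $w_{ij}=0$ otherwise; $\mathcal N_i=\{j:w_{ij}>0\}$. $\lambda_i(W)$ is the $i$-th largest eigenvalue of $W$, and $\rho\in(0,1)$. $\mathbf 1$ is the all-ones vector. DmSGD with full-batch gradients: with initial $x_i^{(0)}$ and $m_i^{(0)}=0$, for $k=0,1,2,\dots$ every node $i$ computes $$m_i^{(k+1)}=\beta m_i^{(k)}+\nabla f_i(x_i^{(k)}),\quad x_i^{(k+\frac12)}=x_i^{(k)}-\gamma m_i^{(k+1)},\quad x_i^{(k+1)}=\sum_{j\in\mathcal N_i}w_{ij}x_j^{(k+\frac12)}.$$ Equivalently, stacking $\mathbf x=[x_1,\dots,x_n]^T$ and $\nabla\mathbf f(\mathbf x)=[\nabla f_1(x_1),\dots,\nabla f_n(x_n)]^T$ in $\mathbb{R}^{n\times d}$: $\mathbf x^{(k+1)}=W(\mathbf x^{(k)}-\gamma\nabla\mathbf f(\mathbf x^{(k)}))+\beta(\mathbf x^{(k)}-W\mathbf x^{(k-1)})$. The inconsistency bias is the limiting error above when there is no gradient noise.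
   Formalization: The learning rate is assumed positive and sufficiently small (below a threshold depending only on n, d, L, the strong convexity modulus, β and ρ), since for large learning rates the iteration diverges and the limit does not exist; also n ≥ 2. *)

theory Defs
  imports
    "HOL-Analysis.Analysis"
    "HOL-Computational_Algebra.Polynomial"
    "HOL-Library.Multiset"
begin

definition charpoly :: "real^'n^'n \<Rightarrow> real poly" where
  "charpoly A = det (\<chi> i j. (if i = j then [:0, 1:] else 0) - [:A $ i $ j:])"

text \<open>Real eigenvalues, repeated according to multiplicity, in decreasing order. A real symmetric
  matrix has exactly as many of them as it has rows.\<close>
definition eigvals_desc :: "real^'n^'n \<Rightarrow> real list" where
  "eigvals_desc A = rev (sorted_list_of_multiset (proots (charpoly A)))"

text \<open>The index is 1-based: \<open>nth_eigval 1 A\<close> is the largest eigenvalue.\<close>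
definition nth_eigval :: "nat \<Rightarrow> real^'n^'n \<Rightarrow> real" where
  "nth_eigval i A = eigvals_desc A ! (i - 1)"

definition mixing_rate :: "real^'n^'n \<Rightarrow> real" where
  "mixing_rate W = max \<bar>nth_eigval 2 W\<bar> \<bar>nth_eigval CARD('n) W\<bar>"

text \<open>\<open>E\<close> is the topology, \<open>(i, j) \<in> E\<close> meaning that node \<open>j\<close> is connected to node \<open>i\<close>.\<close>
definition weights_of :: "('n \<times> 'n) set \<Rightarrow> real^'n^'n \<Rightarrow> bool" where
  "weights_of E W \<longleftrightarrow>
    (\<forall>i j. if (i, j) \<in> E \<or> i = j then W $ i $ j > 0 else W $ i $ j = 0)"

definition strongly_connected :: "('n \<times> 'n) set \<Rightarrow> bool" where
  "strongly_connected E \<longleftrightarrow> (\<forall>i j. (i, j) \<in> E\<^sup>*)"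

definition neighbours :: "real^'n^'n \<Rightarrow> 'n \<Rightarrow> 'n set" where
  "neighbours W i = {j. W $ i $ j > 0}"

definition grad :: "('a::real_inner \<Rightarrow> real) \<Rightarrow> 'a \<Rightarrow> 'a" where
  "grad f x = (THE D. GDERIV f x :> D)"

definition L_smooth :: "real \<Rightarrow> ('a::real_inner \<Rightarrow> real) \<Rightarrow> bool" where
  "L_smooth L f \<longleftrightarrow>
    (\<forall>x. f differentiable (at x)) \<and>
    (\<forall>x y. norm (grad f x - grad f y) \<le> L * norm (x - y))"

definition strongly_convex :: "real \<Rightarrow> ('a::real_inner \<Rightarrow> real) \<Rightarrow> bool" where
  "strongly_convex \<mu> f \<longleftrightarrow>
    (\<forall>x y. \<forall>t\<in>{0..1}.
      f (t *\<^sub>R x + (1 - t) *\<^sub>R y)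
        \<le> t * f x + (1 - t) * f y - \<mu> / 2 * t * (1 - t) * (norm (x - y))\<^sup>2)"

definition avg_objective :: "('n::finite \<Rightarrow> 'a \<Rightarrow> real) \<Rightarrow> 'a \<Rightarrow> real" where
  "avg_objective f x = (1 / real CARD('n)) * (\<Sum>i\<in>UNIV. f i x)"

definition global_minimizer :: "('a \<Rightarrow> real) \<Rightarrow> 'a \<Rightarrow> bool" where
  "global_minimizer f x \<longleftrightarrow> (\<forall>y. f x \<le> f y)"

text \<open>This is \<open>b\<^sup>2\<close>, not \<open>b\<close>, when \<open>x\<close> is the global minimizer.\<close>
definition data_inconsistency_sq :: "('n::finite \<Rightarrow> 'a::real_inner \<Rightarrow> real) \<Rightarrow> 'a \<Rightarrow> real" where
  "data_inconsistency_sq f x = (1 / real CARD('n)) * (\<Sum>i\<in>UNIV. (norm (grad (f i) x))\<^sup>2)"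

text \<open>\<open>x k i\<close> and \<open>m k i\<close> are the iterate and the momentum of node \<open>i\<close> after \<open>k\<close> steps, and
  \<open>xh k i\<close> is its half-step iterate \<open>k + 1/2\<close>. The initial iterates \<open>x 0\<close> are arbitrary.\<close>
definition dmsgd ::
  "real^'n^'n \<Rightarrow> ('n \<Rightarrow> 'a::real_inner \<Rightarrow> real) \<Rightarrow> real \<Rightarrow> real \<Rightarrow>
    (nat \<Rightarrow> 'n \<Rightarrow> 'a) \<Rightarrow> (nat \<Rightarrow> 'n \<Rightarrow> 'a) \<Rightarrow> (nat \<Rightarrow> 'n \<Rightarrow> 'a) \<Rightarrow> bool" where
  "dmsgd W f \<gamma> \<beta> x xh m \<longleftrightarrow>
    (\<forall>i. m 0 i = 0) \<and>
    (\<forall>k i. m (Suc k) i = \<beta> *\<^sub>R m k i + grad (f i) (x k i)) \<and>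
    (\<forall>k i. xh k i = x k i - \<gamma> *\<^sub>R m (Suc k) i) \<and>
    (\<forall>k i. x (Suc k) i = (\<Sum>j\<in>neighbours W i. W $ i $ j *\<^sub>R xh k j))"

end

theory Submission
  imports Defs
begin

text \<open>With \<open>\<eta> = \<gamma> / (1 - \<beta>)\<close>, the stationary points of DmSGD are the solutions of
  \<open>X = W (X - \<eta> \<nabla>f(X))\<close>. For small \<open>\<eta>\<close> the right-hand side is a contraction, since \<open>W\<close> is
  nonexpansive and the gradient step contracts, so there is exactly one. At this point the gradients
  sum to zero and the disagreement between the nodes is at most
  \<open>2 \<eta> \<parallel>\<nabla>f(x\<^sup>\<star>)\<parallel> / (1 - \<rho>)\<close>; strong monotonicity transfers this bound to the distance
  from the minimizer. The iterates converge to the stationary point because a weighted sum of the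
  error, the disagreement and the lag of the momentum decays geometrically. The
  weights of \<open>W\<close> enter only through \<open>\<rho>\<close>: an orthonormal eigenbasis identifies the list of roots of
  the characteristic polynomial with the spectrum, and strong connectedness with positive diagonal
  makes \<open>1\<close> a simple eigenvalue and the only one of modulus at least \<open>1\<close>.\<close>

section \<open>Spectrum of a symmetric weight matrix\<close>

lemma dot_matrix_symmetric:
  fixes A :: "real^'n^'n"
  assumes "transpose A = A"
  shows "(A *v u) \<bullet> w = u \<bullet> (A *v w)"
  by (metis assms dot_lmul_matrix inner_commute vector_transpose_matrix)

text \<open>Near 0 the linear term dominates, so a nonzero slope would make the expression positive
  on one side. This is the first-order condition for the Rayleigh quotient below.\<close>

lemma linear_term_zero_if_quadratic_nonpos:
  fixes a b :: real
  assumes "\<And>t. a * t + b * t\<^sup>2 \<le> 0"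
  shows "a = 0"
proof (rule ccontr)
  assume "a \<noteq> 0"
  define d where "d = \<bar>b\<bar> + 1"
  have d: "d > 0" "d + b > 0" by (auto simp: d_def)
  have "a * (a / d) + b * (a / d)\<^sup>2 = a\<^sup>2 * (d + b) / d\<^sup>2"
    using d by (simp add: field_simps power2_eq_square)
  moreover have "\<dots> > 0"
    using \<open>a \<noteq> 0\<close> d by (intro divide_pos_pos mult_pos_pos) auto
  ultimately show False
    using assms[of "a / d"] by linarith
qed

text \<open>A maximizer of the Rayleigh quotient on the unit sphere of the subspace is an eigenvector.\<close>
lemma symmetric_eigenvector_in_subspace:
  fixes A :: "real^'n^'n"
  assumes sym: "transpose A = A" and S: "subspace S" and inv: "\<And>v. v \<in> S \<Longrightarrow> A *v v \<in> S"
    and ne: "S \<noteq> {0}"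
  obtains v l where "v \<in> S" "norm v = 1" "A *v v = l *\<^sub>R v"
proof -
  have 0: "0 \<in> S" using S by (rule subspace_0)
  then obtain w where w: "w \<in> S" "w \<noteq> 0" using ne by blast
  define K where "K = S \<inter> sphere 0 1"
  have "compact K"
    unfolding K_def by (intro closed_Int_compact closed_subspace S) simp
  moreover have "(1 / norm w) *\<^sub>R w \<in> K"
    using w S by (simp add: K_def subspace_scale)
  moreover have "continuous_on K (\<lambda>v. (A *v v) \<bullet> v)"
    by (intro continuous_on_inner continuous_on_id linear_continuous_on matrix_vector_mul_bounded_linear)
  ultimately obtain v where v: "v \<in> K" and max: "\<And>u. u \<in> K \<Longrightarrow> (A *v u) \<bullet> u \<le> (A *v v) \<bullet> v"
    using continuous_attains_sup[of K "\<lambda>v. (A *v v) \<bullet> v"] by auto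
  define l where "l = (A *v v) \<bullet> v"
  have vS: "v \<in> S" and nv: "norm v = 1" using v by (auto simp: K_def)
  have quad: "(A *v u) \<bullet> u \<le> l * (u \<bullet> u)" if "u \<in> S" for u
  proof (cases "u = 0")
    case False
    have "(1 / norm u) *\<^sub>R u \<in> K"
      using False that S by (simp add: K_def subspace_scale)
    from max[OF this] have "((A *v u) \<bullet> u) / (norm u)\<^sup>2 \<le> l"
      by (simp add: l_def matrix_vector_mult_scaleR power2_eq_square)
    then show ?thesis
      using False by (simp add: divide_simps power2_norm_eq_inner)
  qed simp
  \<comment> \<open>The residual lies in \<open>S\<close> and is orthogonal to \<open>v\<close>.
    Moving from the maximizer along it gains \<open>2 * (r \<bullet> r)\<close> to first order,
    which maximality forces to vanish.\<close>
  define r where "r = A *v v - l *\<^sub>R v"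
  have rS: "r \<in> S" unfolding r_def by (intro subspace_diff subspace_scale inv S vS)
  have vv: "v \<bullet> v = 1" using nv by (simp add: norm_eq_1)
  have vr: "v \<bullet> r = 0" by (simp add: r_def inner_diff_right vv l_def inner_commute)
  have "2 * (r \<bullet> r) * t + ((A *v r) \<bullet> r - l * (r \<bullet> r)) * t\<^sup>2 \<le> 0" for t
  proof -
    have "v + t *\<^sub>R r \<in> S" by (intro subspace_add subspace_scale S vS rS)
    from quad[OF this]
    have le: "(A *v v + t *\<^sub>R (A *v r)) \<bullet> (v + t *\<^sub>R r) \<le> l * ((v + t *\<^sub>R r) \<bullet> (v + t *\<^sub>R r))"
      by (simp only: matrix_vector_right_distrib matrix_vector_mult_scaleR)
    have norm2: "(v + t *\<^sub>R r) \<bullet> (v + t *\<^sub>R r) = 1 + t\<^sup>2 * (r \<bullet> r)"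
      using vr vv by (simp add: inner_add inner_commute[of r v] power2_eq_square)
    have "A *v v = r + l *\<^sub>R v" by (simp add: r_def)
    then have "(A *v v) \<bullet> r = r \<bullet> r" by (simp add: inner_add_left vr)
    then have "(A *v v + t *\<^sub>R (A *v r)) \<bullet> (v + t *\<^sub>R r)
        = l + 2 * t * (r \<bullet> r) + t\<^sup>2 * ((A *v r) \<bullet> r)"
      using dot_matrix_symmetric[OF sym, of r v]
      by (simp add: inner_add l_def inner_commute[of r "A *v v"] power2_eq_square distrib_left)
    with le[unfolded norm2] show ?thesis by (simp add: algebra_simps)
  qed
  then have "2 * (r \<bullet> r) = 0" by (rule linear_term_zero_if_quadratic_nonpos)
  then have "A *v v = l *\<^sub>R v" by (simp add: r_def)
  with vS nv show thesis by (rule that)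
qed

text \<open>A largest orthonormal set of eigenvectors must span: otherwise its orthogonal complement
  is nonzero and, by symmetry, invariant under \<open>A\<close>, so it contains one more unit
  eigenvector.\<close>

lemma symmetric_orthonormal_eigenbasis:
  fixes A :: "real^'n^'n"
  assumes sym: "transpose A = A"
  obtains P l where "orthogonal_matrix P" "\<And>i. A *v (row i P) = l i *\<^sub>R row i P"
proof -
  define ok where "ok B \<longleftrightarrow> pairwise orthogonal B \<and> (\<forall>v\<in>B. norm v = 1 \<and> (\<exists>l. A *v v = l *\<^sub>R v))"
    for B :: "(real^'n) set"
  have ind: "independent B" if "ok B" for B
    using that pairwise_orthogonal_independent unfolding ok_def by (metis norm_zero zero_neq_one)
  have "ok {}" by (simp add: ok_def)
  moreover have "card B \<le> CARD('n)" if "ok B" for B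
    using independent_bound[OF ind[OF that]] by simp
  ultimately obtain B where B: "ok B" and max: "\<And>B'. ok B' \<Longrightarrow> card B' \<le> card B"
    using ex_has_greatest_nat[of ok "{}" card "Suc CARD('n)"] by (metis less_Suc_eq_le)
  have fin: "finite B" using ind[OF B] by (rule finiteI_independent)
  have spanB: "span B = UNIV"
  proof (rule ccontr)
    assume "span B \<noteq> UNIV"
    define S where "S = {w. \<forall>v\<in>B. orthogonal w v}"
    have "S \<noteq> {0}"
    proof -
      have "dim B < DIM(real^'n)"
        using \<open>span B \<noteq> UNIV\<close> dim_eq_full dim_subset_UNIV le_neq_implies_less by blast
      then obtain x where "x \<noteq> 0" "\<And>y. y \<in> span B \<Longrightarrow> orthogonal x y"
        using orthogonal_to_subspace_exists by blast
      then show ?thesis by (auto simp: S_def span_base)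
    qed
    moreover have "subspace S"
      by (auto simp: S_def subspace_def orthogonal_clauses)
    moreover have "A *v w \<in> S" if "w \<in> S" for w
      using that B by (auto simp: S_def ok_def orthogonal_def dot_matrix_symmetric[OF sym])
    ultimately obtain v l where v: "v \<in> S" "norm v = 1" "A *v v = l *\<^sub>R v"
      using symmetric_eigenvector_in_subspace[OF sym] by metis
    have "ok (insert v B)"
      using B v by (auto simp: ok_def S_def pairwise_insert orthogonal_commute)
    moreover have "v \<notin> B"
      using v by (auto simp: S_def orthogonal_self)
    ultimately show False
      using max[of "insert v B"] fin by simp
  qed
  have "card B = CARD('n)"
    using basis_card_eq_dim[of B UNIV] ind[OF B] spanB by simp
  then obtain g :: "'n \<Rightarrow> real^'n" where g: "bij_betw g UNIV B"
    using fin by (metis finite_same_card_bij finite_class.finite_UNIV)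
  have gB: "g i \<in> B" for i using g by (auto simp: bij_betw_def)
  define P where "P = (\<chi> i. g i)"
  have row: "row i P = g i" for i by (simp add: P_def row_def vec_eq_iff)
  have "orthogonal_matrix P"
    using B gB g unfolding orthogonal_matrix_orthonormal_rows row ok_def
    by (metis UNIV_I bij_betw_imp_inj_on inj_on_def pairwiseD)
  moreover have "\<exists>l. \<forall>i. A *v (row i P) = l i *\<^sub>R row i P"
    unfolding row using B gB by (intro choice) (auto simp: ok_def)
  ultimately show thesis using that by blast
qed

text \<open>Diagonalization over the polynomial ring: the constant matrix \<open>c Q\<close>
  intertwines the characteristic matrix \<open>X\<close> with the diagonal matrix \<open>D\<close>,
  and determinants are multiplicative.\<close>

lemma charpoly_eq_prod:
  fixes A :: "real^'n^'n"
  assumes P: "orthogonal_matrix P" and ev: "\<And>i. A *v (row i P) = l i *\<^sub>R row i P"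
  shows "charpoly A = (\<Prod>i\<in>UNIV. [:- l i, 1:])"
proof -
  define c where "c M = (\<chi> i j. [:M $ i $ j:])" for M :: "real^'n^'n"
  define X where "X = (\<chi> i j. ((if i = j then [:0, 1:] else 0) - [:A $ i $ j:] :: real poly))"
  define D where "D = (\<chi> i j. (if i = j then [:- l i, 1:] else 0 :: real poly))"
  define Q where "Q = transpose P"
  have sum_const: "(\<Sum>k\<in>S. [:f k:]) = [:\<Sum>k\<in>S. f k:]" for f :: "'n \<Rightarrow> real" and S
    by (induction S rule: infinite_finite_induct) auto
  have QP: "Q ** P = mat 1" "P ** Q = mat 1"
    using P by (auto simp: Q_def orthogonal_matrix_def)
  have "c P ** c Q = c (P ** Q)"
    by (simp add: c_def matrix_matrix_mult_def vec_eq_iff sum_const mult.commute)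
  also have "c (P ** Q) = mat 1"
    by (auto simp: QP c_def mat_def vec_eq_iff)
  finally have dets: "det (c P) * det (c Q) = 1"
    by (metis det_I det_mul)
  have AQ: "(\<Sum>k\<in>UNIV. A $ i $ k * Q $ k $ j) = l j * Q $ i $ j" for i j
    using ev[of j] by (simp add: Q_def transpose_def matrix_vector_mult_def row_def vec_eq_iff)
  have "X ** c Q = c Q ** D"
  proof -
    have "(\<Sum>k\<in>UNIV. ((if i = k then [:0, 1:] else 0) - [:A $ i $ k:]) * [:Q $ k $ j:])
        = (\<Sum>k\<in>UNIV. [:Q $ i $ k:] * (if k = j then [:- l k, 1:] else 0))" for i j
    proof -
      have "(\<Sum>k\<in>UNIV. ((if i = k then [:0, 1:] else 0) - [:A $ i $ k:]) * [:Q $ k $ j:])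
          = (\<Sum>k\<in>UNIV. (if i = k then [:0, 1:] * [:Q $ k $ j:] else 0) - [:A $ i $ k * Q $ k $ j:])"
        by (intro sum.cong) (auto simp: algebra_simps)
      also have "\<dots> = [:0, 1:] * [:Q $ i $ j:] - [:l j * Q $ i $ j:]"
        by (simp only: sum_subtractf sum_const AQ) simp
      also have "\<dots> = [:Q $ i $ j:] * [:- l j, 1:]" by simp
      also have "\<dots> = (\<Sum>k\<in>UNIV. if k = j then [:Q $ i $ k:] * [:- l k, 1:] else 0)"
        by simp
      also have "\<dots> = (\<Sum>k\<in>UNIV. [:Q $ i $ k:] * (if k = j then [:- l k, 1:] else 0))"
        by (intro sum.cong) auto
      finally show ?thesis .
    qed
    then show ?thesis by (simp add: X_def D_def c_def matrix_matrix_mult_def vec_eq_iff)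
  qed
  then have comm: "det X * det (c Q) = det (c Q) * det D"
    by (metis det_mul)
  \<comment> \<open>\<open>det (c Q)\<close> is cancelled through its inverse
    \<open>det (c P)\<close>, without dividing polynomials.\<close>
  have "det X = (det (c P) * det (c Q)) * det X" by (simp add: dets)
  also have "\<dots> = det (c P) * (det X * det (c Q))" by (simp only: mult_ac)
  also have "\<dots> = (det (c P) * det (c Q)) * det D" by (simp only: comm mult.assoc)
  also have "\<dots> = det D" by (simp add: dets)
  also have "det D = (\<Prod>i\<in>UNIV. [:- l i, 1:])"
    by (subst det_diagonal) (auto simp: D_def)
  finally show ?thesis by (simp add: charpoly_def X_def)
qed

lemma eigvals_desc_eq:
  fixes A :: "real^'n^'n"
  assumes "orthogonal_matrix P" "\<And>i. A *v (row i P) = l i *\<^sub>R row i P"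
  shows "eigvals_desc A = rev (sorted_list_of_multiset (image_mset l (mset_set UNIV)))"
proof -
  have "proots (charpoly A) = (\<Sum>i\<in>UNIV. {#l i#})"
    by (simp add: charpoly_eq_prod[OF assms] proots_prod)
  also have "\<dots> = image_mset l (mset_set UNIV)"
    by (simp add: sum_unfold_sum_mset)
  finally show ?thesis by (simp add: eigvals_desc_def)
qed

text \<open>A strictly largest eigenvalue \<open>1\<close> heads the decreasing list, so the second
  and the last entries are the largest and the smallest of the others and bound their moduli. Two
  nodes guarantee a second entry.\<close>

lemma mixing_rate_eqI:
  fixes W :: "real^'n^'n"
  assumes n: "2 \<le> CARD('n)"
    and P: "orthogonal_matrix P" "\<And>i. W *v (row i P) = l i *\<^sub>R row i P"
    and i0: "l i0 = 1" and less: "\<And>i. i \<noteq> i0 \<Longrightarrow> \<bar>l i\<bar> < 1"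
  shows "mixing_rate W < 1" "\<And>i. i \<noteq> i0 \<Longrightarrow> \<bar>l i\<bar> \<le> mixing_rate W"
proof -
  define M where "M = image_mset l (mset_set (UNIV - {i0}))"
  define ys where "ys = sorted_list_of_multiset M"
  have setys: "set ys = l ` (UNIV - {i0})" by (simp add: ys_def M_def)
  have len: "length ys = CARD('n) - 1"
    by (metis M_def ys_def card_Diff_singleton UNIV_I mset_sorted_list_of_multiset
        size_image_mset size_mset size_mset_set)
  have sorted: "sorted ys" by (simp add: ys_def)
  have "image_mset l (mset_set UNIV) = add_mset 1 M"
    unfolding M_def by (metis i0 UNIV_I finite_class.finite_UNIV image_mset_add_mset mset_set.remove)
  then have "eigvals_desc W = rev (insort 1 ys)"
    by (simp add: eigvals_desc_eq[OF P] ys_def)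
  also have "insort 1 ys = ys @ [1]"
    using setys less by (intro sorted_insort_is_snoc sorted) (fastforce dest: less)
  finally have eig: "eigvals_desc W = 1 # rev ys" by simp
  have ne: "ys \<noteq> []" using len n by auto
  have 2: "nth_eigval 2 W = last ys"
    using ne by (simp add: nth_eigval_def eig hd_rev flip: hd_conv_nth)
  have 3: "nth_eigval CARD('n) W = hd ys"
  proof -
    have "(1 # rev ys) ! (CARD('n) - 1) = last (1 # rev ys)"
      using len n by (metis last_conv_nth length_Cons length_rev list.distinct(1) diff_Suc_1)
    then show ?thesis using ne by (simp add: nth_eigval_def eig last_rev)
  qed
  show "mixing_rate W < 1"
    using ne setys less unfolding mixing_rate_def 2 3
    by (metis DiffE hd_in_set image_iff insertI1 last_in_set max_less_iff_conj)
  fix i assume "i \<noteq> i0"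
  then have "l i \<in> set ys" by (simp add: setys)
  then obtain k where k: "k < length ys" "l i = ys ! k" by (metis in_set_conv_nth)
  have "hd ys \<le> l i" "l i \<le> last ys"
    using k ne sorted by (auto simp: hd_conv_nth last_conv_nth intro!: sorted_nth_mono)
  then show "\<bar>l i\<bar> \<le> mixing_rate W"
    unfolding mixing_rate_def 2 3 by linarith
qed

section \<open>Norm bounds and the spectral gap of the weight matrix\<close>

lemma norm_vec_sq: "(norm X)\<^sup>2 = (\<Sum>i\<in>UNIV. (norm (X $ i))\<^sup>2)"
  for X :: "'a::real_inner^'n"
  by (simp add: power2_norm_eq_inner inner_vec_def)

lemma obtain_max_index:
  fixes f :: "'n::finite \<Rightarrow> real"
  obtains i where "\<And>j. f j \<le> f i"
proof -
  have "Max (range f) \<in> range f" by (rule Max_in) auto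
  then obtain i where "Max (range f) = f i" by blast
  moreover have "f j \<le> Max (range f)" for j by simp
  ultimately show thesis using that by metis
qed

text \<open>By Parseval, \<open>A\<close> scales the coordinate of \<open>u\<close> along
  \<open>row i P\<close> by \<open>l i\<close>. Bounding only eigenvalues with a nonzero coordinate
  lets the lemma serve all vectors and the zero-sum ones alike.\<close>

lemma norm_symmetric_matrix_le:
  fixes A :: "real^'n^'n"
  assumes sym: "transpose A = A"
    and P: "orthogonal_matrix P" "\<And>i. A *v (row i P) = l i *\<^sub>R row i P"
    and r: "0 \<le> r" "\<And>i. row i P \<bullet> u \<noteq> 0 \<Longrightarrow> \<bar>l i\<bar> \<le> r"
  shows "norm (A *v u) \<le> r * norm u"
proof -
  have parseval: "(norm w)\<^sup>2 = (\<Sum>i\<in>UNIV. (row i P \<bullet> w)\<^sup>2)" for w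
  proof -
    have "norm (P *v w) = norm w"
      using P(1) orthogonal_transformation_matrix[of "(*v) P"] orthogonal_transformation_norm by simp
    then have "(norm w)\<^sup>2 = (norm (P *v w))\<^sup>2" by simp
    also have "\<dots> = (\<Sum>i\<in>UNIV. (row i P \<bullet> w)\<^sup>2)"
      by (simp add: norm_vec_sq matrix_vector_mul_component row_def)
    finally show ?thesis .
  qed
  have "(norm (A *v u))\<^sup>2 = (\<Sum>i\<in>UNIV. (l i * (row i P \<bullet> u))\<^sup>2)"
    unfolding parseval by (simp add: dot_matrix_symmetric[OF sym, symmetric] P(2))
  also have "\<dots> \<le> (\<Sum>i\<in>UNIV. r\<^sup>2 * (row i P \<bullet> u)\<^sup>2)"
  proof (rule sum_mono)
    fix i
    show "(l i * (row i P \<bullet> u))\<^sup>2 \<le> r\<^sup>2 * (row i P \<bullet> u)\<^sup>2"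
      using r(2)[of i] by (cases "row i P \<bullet> u = 0") (auto simp: power_mult_distrib abs_le_square_iff[symmetric] r(1))
  qed
  also have "\<dots> = (r * norm u)\<^sup>2"
    by (simp add: power_mult_distrib parseval sum_distrib_left)
  finally show ?thesis
    by (rule power2_le_imp_le) (simp add: r(1))
qed

lemma weights_nonneg: "weights_of E W \<Longrightarrow> 0 \<le> W $ i $ j"
  unfolding weights_of_def by (metis less_eq_real_def)

lemma weights_diag_pos: "weights_of E W \<Longrightarrow> 0 < W $ i $ i"
  unfolding weights_of_def by metis

lemma row_sum_eq_1: "W *v 1 = 1 \<Longrightarrow> (\<Sum>j\<in>UNIV. W $ i $ j) = 1"
  for W :: "real^'n^'n"
  by (simp add: matrix_vector_mult_def vec_eq_iff)

text \<open>Gershgorin's disc at the entry of largest modulus, which the positive diagonal keeps away from \<open>-1\<close>.\<close>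
lemma weights_eigenvalue_bounds:
  fixes W :: "real^'n^'n"
  assumes W: "weights_of E W" "W *v 1 = 1" and ev: "W *v v = l *\<^sub>R v" and v: "v \<noteq> 0"
  shows "- 1 < l" "l \<le> 1"
proof -
  obtain i where max: "\<And>j. \<bar>v $ j\<bar> \<le> \<bar>v $ i\<bar>"
    using obtain_max_index[of "\<lambda>j. \<bar>v $ j\<bar>"] by blast
  have vi: "0 < \<bar>v $ i\<bar>"
  proof (rule ccontr)
    assume "\<not> 0 < \<bar>v $ i\<bar>"
    then have "\<bar>v $ j\<bar> \<le> 0" for j using max[of j] by simp
    then show False using v by (simp add: vec_eq_iff)
  qed
  have "l * v $ i = (\<Sum>j\<in>UNIV. W $ i $ j * v $ j)"
    using ev by (simp add: matrix_vector_mult_def vec_eq_iff)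
  also have "\<dots> = W $ i $ i * v $ i + (\<Sum>j\<in>UNIV - {i}. W $ i $ j * v $ j)"
    by (simp add: sum.remove)
  finally have "\<bar>l - W $ i $ i\<bar> * \<bar>v $ i\<bar> = \<bar>\<Sum>j\<in>UNIV - {i}. W $ i $ j * v $ j\<bar>"
    by (simp add: abs_mult[symmetric] algebra_simps)
  also have "\<dots> \<le> (\<Sum>j\<in>UNIV - {i}. W $ i $ j * \<bar>v $ i\<bar>)"
    by (intro order_trans[OF sum_abs] sum_mono)
      (simp add: abs_mult weights_nonneg[OF W(1)] mult_left_mono max)
  also have "\<dots> = ((\<Sum>j\<in>UNIV. W $ i $ j) - W $ i $ i) * \<bar>v $ i\<bar>"
    by (simp add: sum_distrib_right[symmetric] sum_diff1)
  also have "\<dots> = (1 - W $ i $ i) * \<bar>v $ i\<bar>"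
    by (simp add: row_sum_eq_1[OF W(2)])
  finally have "\<bar>l - W $ i $ i\<bar> \<le> 1 - W $ i $ i" using vi by simp
  then show "- 1 < l" "l \<le> 1" using weights_diag_pos[OF W(1), of i] by auto
qed

text \<open>Maximum principle: a maximal entry is a weighted average of entries not above it, so all
  entries with positive weight in that row are maximal too; paths spread this to every node.\<close>

lemma weights_fixed_vector_constant:
  fixes W :: "real^'n^'n"
  assumes W: "weights_of E W" "W *v 1 = 1" and sc: "strongly_connected E" and fixed: "W *v v = v"
  obtains c where "v = c *\<^sub>R 1"
proof -
  obtain i where max: "\<And>j. v $ j \<le> v $ i"
    using obtain_max_index[of "\<lambda>j. v $ j"] by blast
  have "v $ j = v $ i" if "(i, j) \<in> E\<^sup>*" for j
    using that
  proof (induction rule: rtrancl_induct)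
    case (step j k)
    have "(\<Sum>m\<in>UNIV. W $ j $ m * (v $ j - v $ m)) = (\<Sum>m\<in>UNIV. W $ j $ m) * v $ j - (W *v v) $ j"
      by (simp add: right_diff_distrib sum_subtractf sum_distrib_right matrix_vector_mult_def)
    also have "\<dots> = 0" by (simp add: row_sum_eq_1[OF W(2)] fixed)
    finally have "\<forall>m\<in>UNIV. W $ j $ m * (v $ j - v $ m) = 0"
      using max step.IH weights_nonneg[OF W(1)] by (subst (asm) sum_nonneg_eq_0_iff) auto
    moreover have "0 < W $ j $ k" using W(1) step.hyps unfolding weights_of_def by metis
    ultimately show ?case using step.IH by (metis UNIV_I eq_iff_diff_eq_0 less_irrefl mult_eq_0_iff)
  qed simp
  then have "v = (v $ i) *\<^sub>R 1"
    using sc by (simp add: strongly_connected_def vec_eq_iff)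
  then show thesis by (rule that)
qed

lemma weights_spectral_gap:
  fixes W :: "real^'n^'n"
  assumes n: "2 \<le> CARD('n)" and W: "weights_of E W" "W *v 1 = 1" and sym: "transpose W = W"
    and sc: "strongly_connected E"
  shows "mixing_rate W < 1"
    and "norm (W *v u) \<le> norm u"
    and "(\<Sum>i\<in>UNIV. u $ i) = 0 \<Longrightarrow> norm (W *v u) \<le> mixing_rate W * norm u"
proof -
  obtain P l where P: "orthogonal_matrix P" "\<And>i. W *v (row i P) = l i *\<^sub>R row i P"
    using symmetric_orthonormal_eigenbasis[OF sym] by blast
  have unit: "norm (row i P) = 1" for i
    using P(1) by (simp add: orthogonal_matrix_orthonormal_rows)
  then have nz: "row i P \<noteq> 0" for i by (metis norm_zero zero_neq_one)
  note bounds = weights_eigenvalue_bounds[OF W P(2) nz]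
  have const: "\<exists>c. row i P = c *\<^sub>R 1" if "l i = 1" for i
    using weights_fixed_vector_constant[OF W sc] P(2)[of i] that by (metis scaleR_one)
  \<comment> \<open>\<open>P\<close> is invertible, so some row is not orthogonal to the constant
    vector; symmetry of \<open>W\<close> then forces its eigenvalue to be \<open>1\<close>.\<close>
  obtain i0 where i0: "row i0 P \<bullet> 1 \<noteq> 0"
  proof -
    have "P *v 1 \<noteq> 0"
      using P(1) unfolding orthogonal_matrix_def
      by (metis matrix_vector_mul_assoc matrix_vector_mul_lid matrix_vector_mult_0_right zero_neq_one)
    then show thesis
      using that by (auto simp: vec_eq_iff matrix_vector_mul_component row_def)
  qed
  have l1: "l i0 = 1"
  proof -
    have "row i0 P \<bullet> 1 = l i0 * (row i0 P \<bullet> 1)"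
      using dot_matrix_symmetric[OF sym, of "row i0 P" 1] by (simp add: P(2) W(2))
    then show ?thesis using i0 by simp
  qed
  obtain c0 where c0: "row i0 P = c0 *\<^sub>R 1" using const[OF l1] by blast
  have less: "\<bar>l i\<bar> < 1" if "i \<noteq> i0" for i
  proof -
    \<comment> \<open>Eigenvectors for \<open>1\<close> are constant, and two nonzero constant
      vectors are never orthogonal, so \<open>1\<close> is simple.\<close>
    have "l i \<noteq> 1"
    proof
      assume "l i = 1"
      then obtain c where c: "row i P = c *\<^sub>R 1" using const by blast
      have "orthogonal (row i P) (row i0 P)"
        using P(1) that by (simp add: orthogonal_matrix_orthonormal_rows)
      then show False using nz[of i] nz[of i0] by (auto simp: c c0 orthogonal_def inner_eq_zero_iff)
    qed
    then show ?thesis using bounds[of i] by linarith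
  qed
  note rate = mixing_rate_eqI[OF n P l1 less]
  show "mixing_rate W < 1" by (rule rate)
  show "norm (W *v u) \<le> norm u"
    using norm_symmetric_matrix_le[OF sym P, of 1 u] bounds by (simp add: abs_le_iff less_imp_le minus_le_iff)
  show "norm (W *v u) \<le> mixing_rate W * norm u" if "(\<Sum>i\<in>UNIV. u $ i) = 0"
  proof (rule norm_symmetric_matrix_le[OF sym P])
    show "0 \<le> mixing_rate W" by (simp add: mixing_rate_def)
    fix i assume "row i P \<bullet> u \<noteq> 0"
    moreover have "row i0 P \<bullet> u = 0" using that by (simp add: c0 inner_vec_def sum_distrib_left[symmetric])
    ultimately show "\<bar>l i\<bar> \<le> mixing_rate W" using rate(2) by metis
  qed
qed

section \<open>Stacked iterates\<close>

text \<open>This is \<open>W\<close> tensored with the identity on the space of each node.\<close>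

definition mix :: "real^'n^'n \<Rightarrow> 'a::real_vector^'n \<Rightarrow> 'a^'n" where
  "mix W X = (\<chi> i. \<Sum>j\<in>UNIV. W $ i $ j *\<^sub>R X $ j)"

text \<open>The projection onto consensus; the mean is copied to every node so that the result is
  again a stack.\<close>

definition avg :: "'a::real_vector^'n \<Rightarrow> 'a^'n" where
  "avg X = (\<chi> i. (1 / real CARD('n)) *\<^sub>R (\<Sum>j\<in>UNIV. X $ j))"

definition dev :: "'a::real_vector^'n \<Rightarrow> 'a^'n" where
  "dev X = X - avg X"

lemma mix_diff: "mix W (X - Y) = mix W X - mix W Y"
  by (simp add: mix_def vec_eq_iff scaleR_diff_right sum_subtractf)

lemma mix_scaleR: "mix W (c *\<^sub>R X) = c *\<^sub>R mix W X"
  by (simp add: mix_def vec_eq_iff scaleR_sum_right mult.commute)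

lemma avg_diff: "avg (X - Y) = avg X - avg Y"
  by (simp add: avg_def vec_eq_iff scaleR_diff_right sum_subtractf)

lemma avg_scaleR: "avg (c *\<^sub>R X) = c *\<^sub>R avg X"
  by (simp add: avg_def vec_eq_iff scaleR_sum_right[symmetric])

lemma avg_const: "avg (\<chi> i. c) = (\<chi> i. c)"
  by (simp add: avg_def vec_eq_iff sum_constant_scaleR)

lemma avg_avg: "avg (avg X) = avg X"
  by (simp add: avg_def vec_eq_iff scaleR_left.sum[symmetric] sum_constant_scaleR)

lemma avg_eq_0_iff: "avg X = 0 \<longleftrightarrow> (\<Sum>j\<in>UNIV. X $ j) = 0"
  by (simp add: avg_def vec_eq_iff)

lemma dev_diff: "dev (X - Y) = dev X - dev Y"
  by (simp add: dev_def avg_diff)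

lemma dev_scaleR: "dev (c *\<^sub>R X) = c *\<^sub>R dev X"
  by (simp add: dev_def avg_scaleR scaleR_diff_right)

lemma avg_dev: "avg (dev X) = 0"
  by (simp add: dev_def avg_diff avg_avg)

lemma avg_inner: "avg X \<bullet> Y = X \<bullet> avg Y"
  for X Y :: "'a::real_inner^'n"
  by (simp add: avg_def inner_vec_def inner_sum_left[symmetric] inner_sum_right[symmetric] sum_divide_distrib[symmetric] sum_distrib_left[symmetric])

text \<open>Pythagoras, as \<open>avg\<close> is idempotent and self-adjoint, hence an orthogonal
  projection.\<close>

lemma norm_dev_le: "norm (dev X) \<le> norm X"
  for X :: "'a::real_inner^'n"
proof -
  have "avg X \<bullet> avg X = X \<bullet> avg X"
    by (simp add: avg_inner avg_avg)
  then have "(norm (dev X))\<^sup>2 = (norm X)\<^sup>2 - (norm (avg X))\<^sup>2"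
    by (simp add: dev_def power2_norm_eq_inner inner_diff inner_commute)
  then have "(norm (dev X))\<^sup>2 \<le> (norm X)\<^sup>2" by simp
  then show ?thesis by (rule power2_le_imp_le) simp
qed

lemma norm_vec_sq_Basis: "(norm X)\<^sup>2 = (\<Sum>b\<in>Basis. (norm (\<chi> i. X $ i \<bullet> b))\<^sup>2)"
  for X :: "'a::euclidean_space^'n"
proof -
  have "(norm x)\<^sup>2 = (\<Sum>b\<in>Basis. (x \<bullet> b)\<^sup>2)" for x :: 'a
    unfolding power2_norm_eq_inner by (subst euclidean_inner) (simp add: power2_eq_square)
  then have "(norm X)\<^sup>2 = (\<Sum>i\<in>UNIV. \<Sum>b\<in>Basis. (X $ i \<bullet> b)\<^sup>2)"
    by (simp only: norm_vec_sq)
  also have "\<dots> = (\<Sum>b\<in>Basis. \<Sum>i\<in>UNIV. (X $ i \<bullet> b)\<^sup>2)" by (rule sum.swap)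
  finally show ?thesis by (simp add: norm_vec_sq)
qed

text \<open>\<open>mix W\<close> acts as \<open>W\<close> on each coordinate of the node vectors
  separately, and squared norms add up over an orthonormal basis.\<close>

lemma norm_mix_le:
  fixes X :: "'a::euclidean_space^'n"
  assumes r: "0 \<le> r"
    and le: "\<And>b. norm (W *v (\<chi> i. X $ i \<bullet> b)) \<le> r * norm (\<chi> i. X $ i \<bullet> b)"
  shows "norm (mix W X) \<le> r * norm X"
proof (rule power2_le_imp_le)
  have "(\<chi> i. mix W X $ i \<bullet> b) = W *v (\<chi> i. X $ i \<bullet> b)" for b
    by (simp add: mix_def matrix_vector_mult_def vec_eq_iff inner_sum_left)
  then have "(norm (mix W X))\<^sup>2 = (\<Sum>b\<in>Basis. (norm (W *v (\<chi> i. X $ i \<bullet> b)))\<^sup>2)"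
    by (simp add: norm_vec_sq_Basis[of "mix W X"])
  also have "\<dots> \<le> (\<Sum>b\<in>Basis. (r * norm (\<chi> i. X $ i \<bullet> b))\<^sup>2)"
    by (intro sum_mono power_mono le) simp
  also have "\<dots> = (r * norm X)\<^sup>2"
    by (simp add: power_mult_distrib sum_distrib_left[symmetric] norm_vec_sq_Basis[of X])
  finally show "(norm (mix W X))\<^sup>2 \<le> (r * norm X)\<^sup>2" .
qed (use r in simp)

text \<open>Separates the analysis from spectra and individual functions: \<open>G\<close> stands
  for the stacked gradient, and \<open>\<rho>\<close> enters as a contraction factor on zero-sum
  vectors.\<close>

locale decentralized =
  fixes W :: "real^'n^'n" and \<rho> :: real
    and G :: "'a::euclidean_space^'n \<Rightarrow> 'a^'n" and L \<mu> :: real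
  assumes row_sum: "\<And>i. (\<Sum>j\<in>UNIV. W $ i $ j) = 1"
    and col_sum: "\<And>j. (\<Sum>i\<in>UNIV. W $ i $ j) = 1"
    and nonexpansive: "\<And>u. norm (W *v u) \<le> norm u"
    and contraction: "\<And>u. (\<Sum>i\<in>UNIV. u $ i) = 0 \<Longrightarrow> norm (W *v u) \<le> \<rho> * norm u"
    and rho: "0 \<le> \<rho>" "\<rho> < 1"
    and lipschitz: "\<And>X Y. norm (G X - G Y) \<le> L * norm (X - Y)"
    and monotone: "\<And>X Y. \<mu> * (norm (X - Y))\<^sup>2 \<le> (G X - G Y) \<bullet> (X - Y)"
    and pos: "0 < L" "0 < \<mu>"
begin

lemma avg_mix: "avg (mix W X) = avg X"
proof -
  have "(\<Sum>i\<in>UNIV. \<Sum>j\<in>UNIV. W $ i $ j *\<^sub>R X $ j) = (\<Sum>j\<in>UNIV. \<Sum>i\<in>UNIV. W $ i $ j *\<^sub>R X $ j)"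
    by (rule sum.swap)
  also have "\<dots> = (\<Sum>j\<in>UNIV. X $ j)"
    by (simp add: scaleR_left.sum[symmetric] col_sum)
  finally show ?thesis by (simp add: avg_def mix_def vec_eq_iff)
qed

lemma mix_avg: "mix W (avg X) = avg X"
  by (simp add: avg_def mix_def vec_eq_iff scaleR_left.sum[symmetric] sum_divide_distrib[symmetric] row_sum)

lemma dev_mix: "dev (mix W X) = mix W (dev X)"
  by (simp add: dev_def mix_diff avg_mix mix_avg)

lemma norm_mix: "norm (mix W (X :: 'a^'n)) \<le> norm X"
  using norm_mix_le[of 1 W X] nonexpansive by simp

lemma norm_mix_dev: "norm (mix W (dev (X :: 'a^'n))) \<le> \<rho> * norm (dev X)"
proof (rule norm_mix_le[OF rho(1)])
  fix b :: 'a
  have "(\<Sum>i\<in>UNIV. dev X $ i) = 0"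
    using avg_dev avg_eq_0_iff by blast
  then show "norm (W *v (\<chi> i. dev X $ i \<bullet> b)) \<le> \<rho> * norm (\<chi> i. dev X $ i \<bullet> b)"
    by (intro contraction) (simp add: inner_sum_left[symmetric])
qed

text \<open>In the expanded square, strong monotonicity gains \<open>2 * \<eta> * \<mu>\<close>, of
  which the quadratic gradient term gives back at most half since
  \<open>\<eta> * L\<^sup>2 \<le> \<mu>\<close>.\<close>

lemma gradient_step_contraction:
  assumes "0 \<le> \<eta>" "\<eta> * L\<^sup>2 \<le> \<mu>" "\<eta> * \<mu> \<le> 1"
  shows "norm ((X - \<eta> *\<^sub>R G X) - (Y - \<eta> *\<^sub>R G Y)) \<le> (1 - \<eta> * \<mu> / 2) * norm (X - Y)"
proof (rule power2_le_imp_le)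
  define D where "D = G X - G Y"
  have "(norm D)\<^sup>2 \<le> (L * norm (X - Y))\<^sup>2"
    unfolding D_def using lipschitz by (intro power_mono) auto
  then have "\<eta>\<^sup>2 * (norm D)\<^sup>2 \<le> \<eta>\<^sup>2 * (L\<^sup>2 * (norm (X - Y))\<^sup>2)"
    by (simp add: power_mult_distrib mult_left_mono)
  also have "\<dots> = \<eta> * (\<eta> * L\<^sup>2) * (norm (X - Y))\<^sup>2"
    by (simp add: power2_eq_square)
  also have "\<dots> \<le> \<eta> * \<mu> * (norm (X - Y))\<^sup>2"
    using assms by (intro mult_right_mono mult_left_mono) auto
  finally have 1: "\<eta>\<^sup>2 * (norm D)\<^sup>2 \<le> \<eta> * \<mu> * (norm (X - Y))\<^sup>2" .
  have 2: "\<eta> * (\<mu> * (norm (X - Y))\<^sup>2) \<le> \<eta> * (D \<bullet> (X - Y))"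
    unfolding D_def using monotone assms(1) by (intro mult_left_mono) auto
  have "(X - \<eta> *\<^sub>R G X) - (Y - \<eta> *\<^sub>R G Y) = (X - Y) - \<eta> *\<^sub>R D"
    by (simp add: D_def scaleR_diff_right)
  then have "(norm ((X - \<eta> *\<^sub>R G X) - (Y - \<eta> *\<^sub>R G Y)))\<^sup>2
      = (norm (X - Y))\<^sup>2 - 2 * \<eta> * (D \<bullet> (X - Y)) + \<eta>\<^sup>2 * (norm D)\<^sup>2"
    by (simp only: power2_norm_eq_inner inner_diff_left[of "X - Y"] inner_diff_right[of _ "X - Y"] inner_scaleR_left inner_scaleR_right inner_commute[of "X - Y" D])
      (simp add: power2_eq_square right_diff_distrib)
  also have "\<dots> \<le> (1 - \<eta> * \<mu>) * (norm (X - Y))\<^sup>2"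
    using 1 2 by (simp add: algebra_simps)
  \<comment> \<open>Completing the square: \<open>1 - s \<le> (1 - s / 2)\<^sup>2\<close>.\<close>
  also have "\<dots> \<le> (1 - \<eta> * \<mu> / 2)\<^sup>2 * (norm (X - Y))\<^sup>2"
    using zero_le_square[of "\<eta> * \<mu>"]
    by (intro mult_right_mono) (simp_all add: power2_eq_square algebra_simps)
  finally show "(norm ((X - \<eta> *\<^sub>R G X) - (Y - \<eta> *\<^sub>R G Y)))\<^sup>2 \<le> ((1 - \<eta> * \<mu> / 2) * norm (X - Y))\<^sup>2"
    by (simp only: power_mult_distrib)
  show "0 \<le> (1 - \<eta> * \<mu> / 2) * norm (X - Y)"
    using assms by simp
qed

lemma fixed_point_exists:
  assumes "0 < \<eta>" "\<eta> * L\<^sup>2 \<le> \<mu>" "\<eta> * \<mu> \<le> 1"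
  obtains X where "mix W (X - \<eta> *\<^sub>R G X) = X"
proof -
  have "\<exists>!X. mix W (X - \<eta> *\<^sub>R G X) = X"
  proof (rule banach_fix_type)
    show "0 \<le> 1 - \<eta> * \<mu> / 2" "1 - \<eta> * \<mu> / 2 < 1" using assms pos by auto
    have "norm (mix W (X - \<eta> *\<^sub>R G X) - mix W (Y - \<eta> *\<^sub>R G Y)) \<le> (1 - \<eta> * \<mu> / 2) * norm (X - Y)" for X Y
      unfolding mix_diff[symmetric] using assms
      by (intro order_trans[OF norm_mix] gradient_step_contraction) auto
    then show "\<forall>X Y. dist (mix W (X - \<eta> *\<^sub>R G X)) (mix W (Y - \<eta> *\<^sub>R G Y)) \<le> (1 - \<eta> * \<mu> / 2) * dist X Y"
      by (simp add: dist_norm)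
  qed
  then show thesis using that by blast
qed

text \<open>\<open>X - Z\<close> splits into the disagreement \<open>dev X\<close> and the consensus
  error \<open>avg X - Z\<close>. Strong monotonicity bounds the latter by the former, and the
  contraction of \<open>W\<close> on disagreements bounds the former by the gradients.\<close>

lemma fixed_point_bias:
  assumes fixed: "mix W (X - \<eta> *\<^sub>R G X) = X" and eta: "0 < \<eta>" "\<eta> * L * (1 + L / \<mu>) \<le> (1 - \<rho>) / 2"
    and Z: "avg Z = Z" "avg (G Z) = 0"
  shows "norm (X - Z) \<le> (1 + L / \<mu>) * (2 * \<eta> / (1 - \<rho>)) * norm (G Z)"
proof -
  define Y where "Y = avg X"
  have XY: "X - Y = dev X" by (simp add: Y_def dev_def)
  have "avg X = avg X - \<eta> *\<^sub>R avg (G X)"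
    using arg_cong[OF fixed, of avg] by (simp add: avg_mix avg_diff avg_scaleR)
  then have GX: "avg (G X) = 0" using eta(1) by simp
  have "avg (Y - Z) = Y - Z" by (simp add: Y_def avg_diff avg_avg Z(1))
  then have orth: "U \<bullet> (Y - Z) = 0" if "avg U = 0" for U
    using avg_inner[of U "Y - Z"] that by simp
  have "\<mu> * norm (Y - Z) * norm (Y - Z) \<le> (G Y - G Z) \<bullet> (Y - Z)"
    using monotone[of Y Z] by (simp add: power2_eq_square mult.assoc)
  \<comment> \<open>\<open>G X\<close> and \<open>G Z\<close> have zero average, so both are
    orthogonal to the consensus vector \<open>Y - Z\<close>.\<close>
  also have "\<dots> = (G Y - G X) \<bullet> (Y - Z)"
    using orth[OF GX] orth[OF Z(2)] by (simp add: inner_diff_left)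
  also have "\<dots> \<le> norm (G Y - G X) * norm (Y - Z)" by (rule norm_cauchy_schwarz)
  also have "\<dots> \<le> L * norm (Y - X) * norm (Y - Z)"
    by (intro mult_right_mono lipschitz) simp
  finally have "\<mu> * norm (Y - Z) \<le> L * norm (dev X)"
    using pos by (cases "Y = Z") (auto simp: XY[symmetric] norm_minus_commute)
  then have "norm (Y - Z) \<le> L / \<mu> * norm (dev X)"
    using pos by (simp add: field_simps)
  moreover have "norm (X - Z) \<le> norm (dev X) + norm (Y - Z)"
    using norm_triangle_ineq[of "X - Y" "Y - Z"] by (simp add: XY[symmetric])
  ultimately have XZ: "norm (X - Z) \<le> (1 + L / \<mu>) * norm (dev X)"
    by (simp add: distrib_right)
  \<comment> \<open>This bounds \<open>G X\<close> through \<open>dev X\<close> again; the bound on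
    \<open>\<eta>\<close> keeps the coefficient at half of the gap \<open>1 - \<rho>\<close>, so the
    term can be absorbed.\<close>
  have "norm (G X) \<le> norm (G Z) + norm (G X - G Z)" by (rule norm_triangle_sub)
  also have "\<dots> \<le> norm (G Z) + L * ((1 + L / \<mu>) * norm (dev X))"
    using pos by (intro add_left_mono order_trans[OF lipschitz] mult_left_mono XZ) auto
  finally have "\<eta> * norm (G X) \<le> \<eta> * (norm (G Z) + L * ((1 + L / \<mu>) * norm (dev X)))"
    using eta(1) by simp
  also have "\<dots> = \<eta> * norm (G Z) + (\<eta> * L * (1 + L / \<mu>)) * norm (dev X)"
    by (simp add: algebra_simps)
  also have "\<dots> \<le> \<eta> * norm (G Z) + (1 - \<rho>) / 2 * norm (dev X)"
    by (intro add_left_mono mult_right_mono eta) simp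
  finally have GX_le: "\<eta> * norm (G X) \<le> \<eta> * norm (G Z) + (1 - \<rho>) / 2 * norm (dev X)" .
  have "dev X = mix W (dev X) - \<eta> *\<^sub>R mix W (dev (G X))"
    using arg_cong[OF fixed, of dev] by (simp add: dev_mix dev_diff dev_scaleR mix_diff mix_scaleR)
  then have "norm (dev X) \<le> norm (mix W (dev X)) + \<eta> * norm (mix W (dev (G X)))"
    by (metis norm_triangle_ineq4 norm_scaleR abs_of_pos eta(1))
  also have "\<dots> \<le> \<rho> * norm (dev X) + \<eta> * norm (G X)"
    using eta(1) norm_mix[of "dev (G X)"] norm_dev_le[of "G X"]
    by (intro add_mono norm_mix_dev mult_left_mono) auto
  finally have "norm (dev X) \<le> \<rho> * norm (dev X) + \<eta> * norm (G X)" .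
  moreover have "(1 - \<rho>) / 2 * norm (dev X) = norm (dev X) - \<rho> * norm (dev X) - (1 - \<rho>) / 2 * norm (dev X)"
    by (simp add: field_simps)
  ultimately have "(1 - \<rho>) / 2 * norm (dev X) \<le> \<eta> * norm (G Z)"
    using GX_le by linarith
  then have "norm (dev X) \<le> 2 * \<eta> / (1 - \<rho>) * norm (G Z)"
    using rho(2) by (simp add: field_simps)
  from mult_left_mono[OF this, of "1 + L / \<mu>"] XZ pos show ?thesis
    by (simp add: mult.assoc)
qed

end

section \<open>Convergence of the momentum iteration\<close>

lemma geometric_decay_tendsto_0:
  fixes V :: "nat \<Rightarrow> real"
  assumes "0 \<le> \<theta>" "\<theta> < 1" "\<And>k. 0 \<le> V k" "\<And>k. V (Suc k) \<le> \<theta> * V k"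
  shows "V \<longlonglongrightarrow> 0"
proof (rule tendsto_sandwich[OF _ _ tendsto_const])
  have "V k \<le> \<theta> ^ k * V 0" for k
  proof (induction k)
    case (Suc k)
    then show ?case
      using assms(4)[of k] mult_left_mono[OF Suc assms(1)] by simp
  qed simp
  then show "\<forall>\<^sub>F k in sequentially. V k \<le> \<theta> ^ k * V 0" by simp
  show "(\<lambda>k. \<theta> ^ k * V 0) \<longlonglongrightarrow> 0"
    by (intro tendsto_mult_left_zero LIMSEQ_realpow_zero assms)
qed (simp add: assms(3))

text \<open>The weight of the momentum lag, next to \<open>\<mu> / (8 * L)\<close> for the
  disagreement. Multiplied by the coupling constant \<open>\<beta> * L / (1 - \<beta>)\<close> it
  gives \<open>(1 - \<rho>) / 4\<close> times the disagreement weight.\<close>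

definition lyapunov_weight :: "real \<Rightarrow> real \<Rightarrow> real \<Rightarrow> real \<Rightarrow> real" where
  "lyapunov_weight L \<mu> \<beta> \<rho> = \<mu> / (8 * L) * (1 - \<rho>) * (1 - \<beta>) / (4 * \<beta> * L)"

text \<open>The first two bounds make the gradient step a contraction, the third lets the disagreement absorb
  the change of the gradients, the fourth makes the momentum lag decay in the Lyapunov function.\<close>
definition max_step :: "real \<Rightarrow> real \<Rightarrow> real \<Rightarrow> real \<Rightarrow> real" where
  "max_step L \<mu> \<beta> \<rho> = Min
    {(1 - \<beta>) * \<mu> / L\<^sup>2, (1 - \<beta>) / \<mu>, (1 - \<beta>) * ((1 - \<rho>) / 2) / (L * (1 + L / \<mu>)),
     lyapunov_weight L \<mu> \<beta> \<rho> * ((1 - \<beta>) / 2) / (1 + \<mu> / (8 * L) + \<mu> / (8 * L) * (1 - \<rho>) / 4)}"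

lemma max_step_pos:
  assumes "0 < L" "0 < \<mu>" "0 < \<beta>" "\<beta> < 1" "\<rho> < 1"
  shows "0 < max_step L \<mu> \<beta> \<rho>"
proof -
  have "0 < \<mu> / (8 * L) * (1 - \<rho>) / 4" "0 < \<mu> / (8 * L)" "0 < 1 + L / \<mu>" using assms by (auto intro: add_pos_pos)
  then show ?thesis using assms unfolding max_step_def lyapunov_weight_def
    by (simp add: add_pos_pos)
qed

lemma max_stepD:
  assumes "0 < L" "0 < \<mu>" "0 < \<beta>" "\<beta> < 1" "\<rho> < 1" and le: "\<gamma> \<le> max_step L \<mu> \<beta> \<rho>"
  shows "\<gamma> / (1 - \<beta>) * L\<^sup>2 \<le> \<mu>" "\<gamma> / (1 - \<beta>) * \<mu> \<le> 1"
    "\<gamma> / (1 - \<beta>) * L * (1 + L / \<mu>) \<le> (1 - \<rho>) / 2"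
    "\<gamma> * (1 + \<mu> / (8 * L) + \<mu> / (8 * L) * (1 - \<rho>) / 4) \<le> lyapunov_weight L \<mu> \<beta> \<rho> * ((1 - \<beta>) / 2)"
proof -
  have pos: "0 < 1 + L / \<mu>" "0 < 1 + \<mu> / (8 * L) + \<mu> / (8 * L) * (1 - \<rho>) / 4"
    using assms by (auto intro!: add_pos_pos)
  have 1: "\<gamma> \<le> (1 - \<beta>) * \<mu> / L\<^sup>2" and 2: "\<gamma> \<le> (1 - \<beta>) / \<mu>"
    and 3: "\<gamma> \<le> (1 - \<beta>) * ((1 - \<rho>) / 2) / (L * (1 + L / \<mu>))"
    and 4: "\<gamma> \<le> lyapunov_weight L \<mu> \<beta> \<rho> * ((1 - \<beta>) / 2) / (1 + \<mu> / (8 * L) + \<mu> / (8 * L) * (1 - \<rho>) / 4)"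
    using le unfolding max_step_def by simp_all
  show "\<gamma> / (1 - \<beta>) * L\<^sup>2 \<le> \<mu>" using 1 assms by (simp add: field_simps)
  show "\<gamma> / (1 - \<beta>) * \<mu> \<le> 1" using 2 assms by (simp add: field_simps)
  have "\<gamma> * (L * (1 + L / \<mu>)) \<le> (1 - \<beta>) * ((1 - \<rho>) / 2)"
    using 3 assms pos by (subst (asm) pos_le_divide_eq) auto
  then have "\<gamma> * (L * (1 + L / \<mu>)) / (1 - \<beta>) \<le> (1 - \<rho>) / 2"
    using assms by (subst pos_divide_le_eq) (auto simp: mult.commute)
  then show "\<gamma> / (1 - \<beta>) * L * (1 + L / \<mu>) \<le> (1 - \<rho>) / 2" by (simp add: mult.assoc)
  show "\<gamma> * (1 + \<mu> / (8 * L) + \<mu> / (8 * L) * (1 - \<rho>) / 4) \<le> lyapunov_weight L \<mu> \<beta> \<rho> * ((1 - \<beta>) / 2)"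
    using 4 pos(2) by (subst (asm) pos_le_divide_eq) auto
qed

context decentralized
begin

text \<open>\<open>Q k\<close> is the lag of the momentum behind its stationary value for a frozen gradient. Like the
  disagreement it decays at a rate independent of \<open>\<gamma>\<close>, while the error itself contracts only at
  rate \<open>1 - O(\<gamma>)\<close>; the weights of the Lyapunov function \<open>V\<close> let the fast decay absorb the coupling.\<close>
lemma dmsgd_tendsto_fixed_point:
  fixes X M :: "nat \<Rightarrow> 'a^'n"
  assumes beta: "0 < \<beta>" "\<beta> < 1" and gamma: "0 < \<gamma>" "\<gamma> \<le> max_step L \<mu> \<beta> \<rho>"
    and M: "\<And>k. M (Suc k) = \<beta> *\<^sub>R M k + G (X k)"
    and X: "\<And>k. X (Suc k) = mix W (X k - \<gamma> *\<^sub>R M (Suc k))"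
    and fixed: "mix W (F - (\<gamma> / (1 - \<beta>)) *\<^sub>R G F) = F"
  shows "X \<longlonglongrightarrow> F"
proof -
  define \<eta> where "\<eta> = \<gamma> / (1 - \<beta>)"
  \<comment> \<open>\<open>K\<close> is the factor with which a move of the iterates enters the lag.
    \<open>A\<close> makes \<open>A * (\<eta> * L)\<close> equal to
    \<open>\<eta> * \<mu> / 8\<close>, half of the margin \<open>\<eta> * \<mu> / 4\<close> that the
    error rate gives up.\<close>
  define K where "K = \<beta> * L / (1 - \<beta>)"
  define A where "A = \<mu> / (8 * L)"
  define B where "B = lyapunov_weight L \<mu> \<beta> \<rho>"
  note bounds = max_stepD[OF pos beta rho(2) gamma(2), folded \<eta>_def A_def B_def]
  have eta: "0 < \<eta>" and K: "0 < K" and A: "0 < A" and B: "0 < B"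
    using beta gamma pos rho by (simp_all add: \<eta>_def K_def A_def B_def lyapunov_weight_def)
  have BK: "B * K = A * (1 - \<rho>) / 4"
    using beta pos by (simp add: B_def K_def A_def lyapunov_weight_def)
  have AL: "A * L = \<mu> / 8" using pos by (simp add: A_def)
  define Q where "Q k = M (Suc k) - (1 / (1 - \<beta>)) *\<^sub>R G (X k)" for k
  define T where "T Y = Y - \<eta> *\<^sub>R G Y" for Y
  define e where "e k = X k - F" for k
  define D where "D k = G (X k) - G F" for k
  \<comment> \<open>Splitting off the stationary momentum leaves a gradient step of length
    \<open>\<eta>\<close>, disturbed by the lag.\<close>
  have e_step: "e (Suc k) = mix W (T (X k) - T F - \<gamma> *\<^sub>R Q k)" for k
  proof -
    have "X k - \<gamma> *\<^sub>R M (Suc k) = T (X k) - \<gamma> *\<^sub>R Q k"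
      by (simp add: T_def Q_def \<eta>_def scaleR_diff_right)
    moreover have "mix W (T F) = F" using fixed by (simp add: T_def \<eta>_def)
    ultimately show ?thesis
      by (simp add: e_def X mix_diff)
  qed
  have T_diff: "T (X k) - T F = e k - \<eta> *\<^sub>R D k" for k
    by (simp add: T_def e_def D_def scaleR_diff_right)
  have D_le: "norm (D k) \<le> L * norm (e k)" for k
    unfolding D_def e_def by (rule lipschitz)
  have a_step: "norm (e (Suc k)) \<le> (1 - \<eta> * \<mu> / 2) * norm (e k) + \<gamma> * norm (Q k)" for k
  proof -
    have "norm (e (Suc k)) \<le> norm (T (X k) - T F - \<gamma> *\<^sub>R Q k)"
      unfolding e_step by (rule norm_mix)
    also have "\<dots> \<le> norm (T (X k) - T F) + \<gamma> * norm (Q k)"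
      using norm_triangle_ineq4[of "T (X k) - T F" "\<gamma> *\<^sub>R Q k"] gamma(1) by simp
    also have "norm (T (X k) - T F) \<le> (1 - \<eta> * \<mu> / 2) * norm (e k)"
      unfolding T_def e_def using eta bounds by (intro gradient_step_contraction) auto
    finally show ?thesis by simp
  qed
  have perturb: "norm (\<eta> *\<^sub>R D k + \<gamma> *\<^sub>R Q k) \<le> \<eta> * L * norm (e k) + \<gamma> * norm (Q k)" for k
  proof -
    have "norm (\<eta> *\<^sub>R D k + \<gamma> *\<^sub>R Q k) \<le> \<eta> * norm (D k) + \<gamma> * norm (Q k)"
      using norm_triangle_ineq[of "\<eta> *\<^sub>R D k" "\<gamma> *\<^sub>R Q k"] eta gamma(1) by simp
    also have "\<eta> * norm (D k) \<le> \<eta> * (L * norm (e k))"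
      using eta by (intro mult_left_mono D_le) simp
    finally show ?thesis by (simp add: mult.assoc)
  qed
  have e_step': "e (Suc k) = mix W (e k) - mix W (\<eta> *\<^sub>R D k + \<gamma> *\<^sub>R Q k)" for k
    unfolding e_step T_diff mix_diff[symmetric] by (simp add: algebra_simps)
  have s_step: "norm (dev (e (Suc k))) \<le> \<rho> * norm (dev (e k)) + \<eta> * L * norm (e k) + \<gamma> * norm (Q k)" for k
  proof -
    let ?p = "\<eta> *\<^sub>R D k + \<gamma> *\<^sub>R Q k"
    have "dev (e (Suc k)) = mix W (dev (e k)) - dev (mix W ?p)"
      unfolding e_step' by (simp add: dev_diff dev_mix)
    then have "norm (dev (e (Suc k))) \<le> norm (mix W (dev (e k))) + norm (dev (mix W ?p))"
      by (simp add: norm_triangle_ineq4)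
    also have "\<dots> \<le> \<rho> * norm (dev (e k)) + norm ?p"
      by (intro add_mono norm_mix_dev order_trans[OF norm_dev_le norm_mix])
    finally show ?thesis using perturb[of k] by simp
  qed
  \<comment> \<open>Since \<open>mix W\<close> fixes averages, \<open>mix W (e k) - e k\<close>
    involves only the disagreement. Thus \<open>norm (e k)\<close> appears only with the factor
    \<open>\<eta>\<close>, which the slow rate of the error can absorb.\<close>
  have drift: "norm (e (Suc k) - e k) \<le> 2 * norm (dev (e k)) + \<eta> * L * norm (e k) + \<gamma> * norm (Q k)" for k
  proof -
    let ?p = "\<eta> *\<^sub>R D k + \<gamma> *\<^sub>R Q k"
    have eq: "e (Suc k) - e k = mix W (dev (e k)) - dev (e k) - mix W ?p"
      unfolding e_step' by (simp add: dev_def mix_diff mix_avg)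
    have "norm (e (Suc k) - e k) \<le> norm (mix W (dev (e k))) + norm (dev (e k)) + norm (mix W ?p)"
      unfolding eq using norm_triangle_ineq4[of "mix W (dev (e k)) - dev (e k)" "mix W ?p"]
        norm_triangle_ineq4[of "mix W (dev (e k))" "dev (e k)"] by linarith
    then show ?thesis
      using norm_mix[of "dev (e k)"] norm_mix[of ?p] perturb[of k] by linarith
  qed
  have q_step: "norm (Q (Suc k)) \<le> \<beta> * norm (Q k)
      + K * (2 * norm (dev (e k)) + \<eta> * L * norm (e k) + \<gamma> * norm (Q k))" for k
  proof -
    have coeff: "1 / (1 - \<beta>) - 1 = \<beta> / (1 - \<beta>)" using beta by (simp add: field_simps)
    \<comment> \<open>The new gradient enters the momentum with coefficient 1 and the stationary
      value with \<open>1 / (1 - \<beta>)\<close>; the remaining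
      \<open>\<beta> / (1 - \<beta>)\<close> is what turns
      \<open>\<beta> *\<^sub>R M (Suc k)\<close> into a lag, up to the change of the
      gradient.\<close>
    have "Q (Suc k) = \<beta> *\<^sub>R M (Suc k) - (1 / (1 - \<beta>) - 1) *\<^sub>R G (X (Suc k))"
      by (simp add: Q_def M[of "Suc k"] scaleR_diff_left)
    also have "\<dots> = \<beta> *\<^sub>R Q k + (\<beta> / (1 - \<beta>)) *\<^sub>R (G (X k) - G (X (Suc k)))"
      unfolding coeff by (simp add: Q_def scaleR_diff_right)
    finally have "norm (Q (Suc k)) \<le> \<beta> * norm (Q k) + \<beta> / (1 - \<beta>) * norm (G (X k) - G (X (Suc k)))"
      using norm_triangle_ineq[of "\<beta> *\<^sub>R Q k" "(\<beta> / (1 - \<beta>)) *\<^sub>R (G (X k) - G (X (Suc k)))"] beta by simp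
    also have "\<dots> \<le> \<beta> * norm (Q k) + \<beta> / (1 - \<beta>) * (L * norm (e (Suc k) - e k))"
      using lipschitz[of "X k" "X (Suc k)"] beta
      by (intro add_left_mono mult_left_mono) (auto simp: e_def norm_minus_commute)
    also have "\<dots> = \<beta> * norm (Q k) + K * norm (e (Suc k) - e k)"
      by (simp add: K_def)
    finally show ?thesis using mult_left_mono[OF drift[of k], of K] K by linarith
  qed
  define V where "V k = norm (e k) + A * norm (dev (e k)) + B * norm (Q k)" for k
  \<comment> \<open>Each of the three rates gives up half of its own margin below 1 to pay for the
    coupling terms.\<close>
  define \<theta> where "\<theta> = max (1 - \<eta> * \<mu> / 4) (max ((1 + \<rho>) / 2) ((1 + \<beta>) / 2))"
  have V_step: "V (Suc k) \<le> \<theta> * V k" for k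
  proof -
    define a s q where "a = norm (e k)" "s = norm (dev (e k))" "q = norm (Q k)"
    note asq = a_s_q_def
    have nonneg: "0 \<le> a" "0 \<le> s" "0 \<le> q" by (simp_all add: asq)
    have ca: "1 - \<eta> * \<mu> / 2 + A * (\<eta> * L) + B * (K * (\<eta> * L)) \<le> \<theta>"
    proof -
      have "B * (K * (\<eta> * L)) = (B * K) * (\<eta> * L)" by simp
      also have "\<dots> = (1 - \<rho>) / 4 * (\<eta> * (A * L))" unfolding BK by simp
      also have "\<dots> \<le> 1 * (\<eta> * (A * L))" using rho eta A pos by (intro mult_right_mono) auto
      finally have "B * (K * (\<eta> * L)) \<le> \<eta> * \<mu> / 8" by (simp add: AL)
      moreover have "A * (\<eta> * L) = \<eta> * \<mu> / 8" using AL by (simp add: mult.left_commute)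
      moreover have "1 - \<eta> * \<mu> / 4 \<le> \<theta>" by (simp add: \<theta>_def)
      ultimately show ?thesis by linarith
    qed
    have cs: "A * \<rho> + 2 * (B * K) \<le> \<theta> * A"
    proof -
      have "A * \<rho> + 2 * (B * K) = (1 + \<rho>) / 2 * A" by (simp add: BK field_simps)
      also have "\<dots> \<le> \<theta> * A" using A by (intro mult_right_mono) (auto simp: \<theta>_def le_max_iff_disj)
      finally show ?thesis .
    qed
    have cq: "\<gamma> + A * \<gamma> + B * (\<beta> + K * \<gamma>) \<le> \<theta> * B"
    proof -
      have "\<gamma> + A * \<gamma> + B * (\<beta> + K * \<gamma>) = \<gamma> * (1 + A + B * K) + B * \<beta>" by (simp add: algebra_simps)
      also have "\<dots> \<le> B * ((1 - \<beta>) / 2) + B * \<beta>" using bounds(4) by (simp add: BK)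
      also have "\<dots> = (1 + \<beta>) / 2 * B" by (simp add: field_simps)
      also have "\<dots> \<le> \<theta> * B" using B by (intro mult_right_mono) (auto simp: \<theta>_def le_max_iff_disj)
      finally show ?thesis .
    qed
    have "V (Suc k) \<le> ((1 - \<eta> * \<mu> / 2) * a + \<gamma> * q) + A * (\<rho> * s + \<eta> * L * a + \<gamma> * q)
        + B * (\<beta> * q + K * (2 * s + \<eta> * L * a + \<gamma> * q))"
      unfolding V_def asq using A B a_step s_step q_step by (intro add_mono mult_left_mono) auto
    also have "\<dots> = (1 - \<eta> * \<mu> / 2 + A * (\<eta> * L) + B * (K * (\<eta> * L))) * a
        + (A * \<rho> + 2 * (B * K)) * s + (\<gamma> + A * \<gamma> + B * (\<beta> + K * \<gamma>)) * q"
      by (simp add: algebra_simps)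
    also have "\<dots> \<le> \<theta> * a + (\<theta> * A) * s + (\<theta> * B) * q"
      by (intro add_mono mult_right_mono ca cs cq nonneg)
    also have "\<dots> = \<theta> * V k" by (simp add: V_def asq algebra_simps)
    finally show ?thesis .
  qed
  have "V \<longlonglongrightarrow> 0"
  proof (rule geometric_decay_tendsto_0)
    show "0 \<le> \<theta>" using rho by (simp add: \<theta>_def le_max_iff_disj)
    show "\<theta> < 1" using rho beta eta pos by (simp add: \<theta>_def)
    show "0 \<le> V k" for k using A B by (simp add: V_def)
  qed (fact V_step)
  moreover have "norm (e k) \<le> V k" for k using A B by (simp add: V_def)
  ultimately have "e \<longlonglongrightarrow> 0" by (intro Lim_null_comparison[of e V]) auto
  then show ?thesis unfolding e_def by (simp add: LIM_zero_iff)
qed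

end

section \<open>Gradients of strongly convex functions\<close>

text \<open>The derivative is the inner product with its adjoint at \<open>1\<close>; uniqueness of
  derivatives makes the description in \<open>grad\<close> definite.\<close>

lemma GDERIV_grad:
  fixes f :: "'a::euclidean_space \<Rightarrow> real"
  assumes "f differentiable (at x)"
  shows "GDERIV f x :> grad f x"
proof -
  obtain f' where f': "(f has_derivative f') (at x)"
    using assms by (auto simp: differentiable_def)
  define D where "D = adjoint f' 1"
  have "f' h = h \<bullet> D" for h
    using adjoint_works[OF has_derivative_linear[OF f'], of h 1] by (simp add: D_def)
  then have "f' = (\<lambda>h. h \<bullet> D)" by (rule ext)
  then have D: "GDERIV f x :> D"
    using f' by (simp add: gderiv_def)
  moreover have "D' = D" if "GDERIV f x :> D'" for D'
    using has_derivative_unique[OF that[unfolded gderiv_def] D[unfolded gderiv_def]]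
    by (metis vector_eq_ldot)
  ultimately have "grad f x = D"
    unfolding grad_def by (rule the_equality)
  with D show ?thesis by simp
qed

text \<open>Convexity on the segment from \<open>y\<close> to \<open>x\<close> bounds the difference
  quotients at \<open>y\<close>; let \<open>t\<close> tend to 0 from the right.\<close>

lemma strongly_convex_gradient_bound:
  assumes sc: "strongly_convex \<mu> f" and D: "GDERIV f y :> D"
  shows "f y + (x - y) \<bullet> D + \<mu> / 2 * (norm (x - y))\<^sup>2 \<le> f x"
proof -
  define g where "g t = f (y + t *\<^sub>R (x - y))" for t
  have "((\<lambda>t. y + t *\<^sub>R (x - y)) has_derivative (\<lambda>t. t *\<^sub>R (x - y))) (at 0)"
    by (auto intro!: derivative_eq_intros)
  moreover have "(f has_derivative (\<lambda>h. h \<bullet> D)) (at (y + 0 *\<^sub>R (x - y)))"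
    using D by (simp add: gderiv_def)
  ultimately have "(g has_derivative (\<lambda>t. (t *\<^sub>R (x - y)) \<bullet> D)) (at 0)"
    unfolding g_def by (rule has_derivative_compose)
  then have "DERIV g 0 :> (x - y) \<bullet> D"
    by (simp add: has_field_derivative_def mult_commute_abs)
  then have "((\<lambda>t. (g t - g 0) / t) \<longlongrightarrow> (x - y) \<bullet> D) (at 0)"
    by (simp only: DERIV_def add_0)
  then have "((\<lambda>t. (g t - g 0) / t) \<longlongrightarrow> (x - y) \<bullet> D) (at_right 0)"
    by (rule tendsto_within_subset) (rule subset_UNIV)
  moreover have "((\<lambda>t. f x - f y - \<mu> / 2 * (1 - t) * (norm (x - y))\<^sup>2)
      \<longlongrightarrow> f x - f y - \<mu> / 2 * (1 - 0) * (norm (x - y))\<^sup>2) (at_right 0)"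
    by (intro tendsto_intros)
  moreover have "\<forall>\<^sub>F t in at_right 0. (g t - g 0) / t \<le> f x - f y - \<mu> / 2 * (1 - t) * (norm (x - y))\<^sup>2"
  proof (rule eventually_at_rightI[of 0 1])
    fix t :: real assume t: "t \<in> {0<..<1}"
    have "t *\<^sub>R x + (1 - t) *\<^sub>R y = y + t *\<^sub>R (x - y)" by (simp add: algebra_simps)
    then have "g t \<le> t * f x + (1 - t) * f y - \<mu> / 2 * t * (1 - t) * (norm (x - y))\<^sup>2"
      using sc t unfolding strongly_convex_def g_def by (metis atLeastAtMost_iff greaterThanLessThan_iff less_imp_le)
    then have "g t - g 0 \<le> (f x - f y - \<mu> / 2 * (1 - t) * (norm (x - y))\<^sup>2) * t"
      by (simp add: g_def algebra_simps)
    then show "(g t - g 0) / t \<le> f x - f y - \<mu> / 2 * (1 - t) * (norm (x - y))\<^sup>2"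
      using t by (subst pos_divide_le_eq) auto
  qed simp
  ultimately have "(x - y) \<bullet> D \<le> f x - f y - \<mu> / 2 * (1 - 0) * (norm (x - y))\<^sup>2"
    by (intro tendsto_le[of "at_right (0::real)"]) auto
  then show ?thesis by simp
qed

text \<open>Add the gradient bounds for \<open>x, y\<close> and \<open>y, x\<close>: the function
  values cancel and the two halves of \<open>\<mu>\<close> combine.\<close>

lemma grad_strongly_monotone:
  fixes f :: "'a::euclidean_space \<Rightarrow> real"
  assumes "L_smooth L f" "strongly_convex \<mu> f"
  shows "\<mu> * (norm (x - y))\<^sup>2 \<le> (grad f x - grad f y) \<bullet> (x - y)"
proof -
  have D: "GDERIV f z :> grad f z" for z
    using assms(1) by (intro GDERIV_grad) (simp add: L_smooth_def)
  show ?thesis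
    using strongly_convex_gradient_bound[OF assms(2) D, of x y]
      strongly_convex_gradient_bound[OF assms(2) D, of y x]
    by (simp add: inner_diff inner_commute norm_minus_commute)
qed

lemma sum_grad_at_minimizer:
  fixes f :: "'n::finite \<Rightarrow> 'a::euclidean_space \<Rightarrow> real"
  assumes "\<And>i. f i differentiable (at z)" "global_minimizer (avg_objective f) z"
  shows "(\<Sum>i\<in>UNIV. grad (f i) z) = 0"
proof -
  let ?S = "\<Sum>i\<in>UNIV. grad (f i) z"
  have "((\<lambda>x. \<Sum>i\<in>UNIV. f i x) has_derivative (\<lambda>h. \<Sum>i\<in>UNIV. h \<bullet> grad (f i) z)) (at z)"
    using GDERIV_grad[OF assms(1)] by (intro has_derivative_sum) (simp add: gderiv_def)
  then have "((\<lambda>x. \<Sum>i\<in>UNIV. f i x) has_derivative (\<lambda>h. h \<bullet> ?S)) (at z)"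
    by (simp add: inner_sum_right)
  moreover have "(\<Sum>i\<in>UNIV. f i z) \<le> (\<Sum>i\<in>UNIV. f i y)" for y
    using assms(2) by (simp add: global_minimizer_def avg_objective_def divide_le_cancel)
  ultimately have "(\<lambda>h. h \<bullet> ?S) = (\<lambda>h. 0)"
    by (intro has_derivative_local_min) auto
  then have "?S \<bullet> ?S = 0" by metis
  then show ?thesis by simp
qed

section \<open>Instantiation with given functions and weights, and the final bound\<close>

definition stacked_grad :: "('n \<Rightarrow> 'a::real_inner \<Rightarrow> real) \<Rightarrow> 'a^'n \<Rightarrow> 'a^'n" where
  "stacked_grad f X = (\<chi> i. grad (f i) (X $ i))"

text \<open>The Lipschitz and monotonicity bounds hold node by node and add up. \<open>L'\<close>
  may exceed \<open>L\<close>, so that the setting has a positive constant even when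
  \<open>L\<close> is not positive.\<close>

lemma decentralized_stacked_grad:
  fixes W :: "real^'n^'n" and f :: "'n \<Rightarrow> 'a::euclidean_space \<Rightarrow> real"
  assumes n: "2 \<le> CARD('n)" and W: "weights_of E W" "W *v 1 = 1" and sym: "transpose W = W"
    and sc: "strongly_connected E" and L: "L \<le> L'" "0 < L'" and \<mu>: "0 < \<mu>"
    and f: "\<And>i. L_smooth L (f i)" "\<And>i. strongly_convex \<mu> (f i)"
  shows "decentralized W (mixing_rate W) (stacked_grad f) L' \<mu>"
proof
  fix u :: "real^'n" and i j :: 'n and X Y :: "'a^'n"
  note gap = weights_spectral_gap[OF n W sym sc]
  show "(\<Sum>j\<in>UNIV. W $ i $ j) = 1" by (rule row_sum_eq_1[OF W(2)])
  have "W $ k $ j = W $ j $ k" for k using sym by (simp add: transpose_def vec_eq_iff)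
  then show "(\<Sum>i\<in>UNIV. W $ i $ j) = 1" using row_sum_eq_1[OF W(2), of j] by simp
  show "norm (W *v u) \<le> norm u" by (rule gap)
  show "norm (W *v u) \<le> mixing_rate W * norm u" if "(\<Sum>i\<in>UNIV. u $ i) = 0" using that by (rule gap)
  show "0 \<le> mixing_rate W" by (simp add: mixing_rate_def)
  show "mixing_rate W < 1" by (rule gap)
  show "norm (stacked_grad f X - stacked_grad f Y) \<le> L' * norm (X - Y)"
  proof (rule power2_le_imp_le)
    have "norm (grad (f i) (X $ i) - grad (f i) (Y $ i)) \<le> L' * norm (X $ i - Y $ i)" for i
      using f(1)[of i] L mult_right_mono[OF L(1) norm_ge_zero] unfolding L_smooth_def by (meson order_trans)
    then have "(norm (stacked_grad f X - stacked_grad f Y))\<^sup>2 \<le> (\<Sum>i\<in>UNIV. (L' * norm (X $ i - Y $ i))\<^sup>2)"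
      by (simp add: norm_vec_sq stacked_grad_def sum_mono power_mono)
    also have "\<dots> = (L' * norm (X - Y))\<^sup>2"
      by (simp add: power_mult_distrib norm_vec_sq sum_distrib_left)
    finally show "(norm (stacked_grad f X - stacked_grad f Y))\<^sup>2 \<le> (L' * norm (X - Y))\<^sup>2" .
  qed (use L in simp)
  show "\<mu> * (norm (X - Y))\<^sup>2 \<le> (stacked_grad f X - stacked_grad f Y) \<bullet> (X - Y)"
    using grad_strongly_monotone[OF f]
    by (simp add: norm_vec_sq inner_vec_def stacked_grad_def sum_distrib_left sum_mono)
qed (use L \<mu> in auto)

text \<open>Choosing \<open>C\<close> before \<open>\<beta>\<close> and \<open>\<rho>\<close> makes
  the dependence on \<open>1 - \<beta>\<close> and \<open>1 - \<rho>\<close> explicit. How small the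
  step must be may depend on both, but not on the graph, the functions or the starting
  point.\<close>

theorem proposition2:
  fixes L \<mu> :: real
  assumes "2 \<le> CARD('n::finite)"
    and "0 < \<mu>"
  shows "\<exists>C>0. \<forall>\<beta> \<rho>. 0 < \<beta> \<and> \<beta> < 1 \<longrightarrow>
    (\<exists>\<gamma>0>0. \<forall>(E :: ('n \<times> 'n) set) (W :: real^'n^'n) (f :: 'n \<Rightarrow> real^'d \<Rightarrow> real) xstar \<gamma> x xh m.
      sym E \<and> strongly_connected E \<and>
      weights_of E W \<and> transpose W = W \<and> W *v 1 = 1 \<and> \<rho> = mixing_rate W \<and>
      (\<forall>i. L_smooth L (f i)) \<and> (\<forall>i. strongly_convex \<mu> (f i)) \<and>
      global_minimizer (avg_objective f) xstar \<and>
      0 < \<gamma> \<and> \<gamma> \<le> \<gamma>0 \<and> dmsgd W f \<gamma> \<beta> x xh m \<longrightarrow>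
      (\<exists>l. (\<lambda>k. \<Sum>i\<in>UNIV. (norm (x k i - xstar))\<^sup>2) \<longlonglongrightarrow> l \<and>
        l \<le> C * (\<gamma>\<^sup>2 * data_inconsistency_sq f xstar / ((1 - \<beta>)\<^sup>2 * (1 - \<rho>)\<^sup>2))))"
proof -
  define L' where "L' = max L 1"
  have L': "L \<le> L'" "0 < L'" by (auto simp: L'_def)
  \<comment> \<open>The squared constant of \<open>fixed_point_bias\<close>; the factor
    \<open>CARD('n)\<close> turns the average in \<open>data_inconsistency_sq\<close> into the
    squared norm of the stacked gradient.\<close>
  define C where "C = 4 * real CARD('n) * (1 + L' / \<mu>)\<^sup>2"
  have "0 < 1 + L' / \<mu>" using L' assms by (simp add: add_pos_pos)
  then have C: "0 < C" by (simp add: C_def)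
  have main: "\<exists>l. (\<lambda>k. \<Sum>i\<in>UNIV. (norm (x k i - xstar))\<^sup>2) \<longlonglongrightarrow> l \<and>
      l \<le> C * (\<gamma>\<^sup>2 * data_inconsistency_sq f xstar / ((1 - \<beta>)\<^sup>2 * (1 - \<rho>)\<^sup>2))"
    if beta: "0 < \<beta>" "\<beta> < 1" and sc: "strongly_connected E"
      and W: "weights_of E W" "W *v 1 = 1" and sym: "transpose W = W" and rho: "\<rho> = mixing_rate W"
      and f: "\<And>i. L_smooth L (f i)" "\<And>i. strongly_convex \<mu> (f i)"
      and min: "global_minimizer (avg_objective f) xstar"
      and gamma: "0 < \<gamma>" "\<rho> < 1 \<Longrightarrow> \<gamma> \<le> max_step L' \<mu> \<beta> \<rho>" and alg: "dmsgd W f \<gamma> \<beta> x xh m"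
    for \<beta> \<rho> \<gamma> and E :: "('n \<times> 'n) set" and W :: "real^'n^'n" and f :: "'n \<Rightarrow> real^'d \<Rightarrow> real" and xstar x xh m
  proof -
    define G where "G = stacked_grad f"
    interpret decentralized W \<rho> G L' \<mu>
      unfolding rho G_def by (rule decentralized_stacked_grad[OF assms(1) W sym sc L' assms(2) f])
    note step = gamma(2)[OF rho(2)]
    define \<eta> where "\<eta> = \<gamma> / (1 - \<beta>)"
    have eta: "0 < \<eta>" using gamma beta by (simp add: \<eta>_def)
    note bounds = max_stepD[OF pos beta rho(2) step, folded \<eta>_def]
    obtain F where F: "mix W (F - \<eta> *\<^sub>R G F) = F"
      using fixed_point_exists[OF eta bounds(1,2)] by blast
    define X where "X k = (\<chi> i. x k i)" for k
    define M where "M k = (\<chi> i. m k i)" for k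
    define Z :: "(real^'d)^'n" where "Z = (\<chi> i. xstar)"
    have M_step: "M (Suc k) = \<beta> *\<^sub>R M k + G (X k)" for k
      using alg by (simp add: dmsgd_def M_def X_def G_def stacked_grad_def vec_eq_iff)
    have X_step: "X (Suc k) = mix W (X k - \<gamma> *\<^sub>R M (Suc k))" for k
    proof -
      have "x (Suc k) i = (\<Sum>j\<in>UNIV. W $ i $ j *\<^sub>R xh k j)" for i
      proof -
        have "W $ i $ j = 0" if "j \<notin> neighbours W i" for j
          using that weights_nonneg[OF W(1), of i j] by (simp add: neighbours_def)
        then have "(\<Sum>j\<in>neighbours W i. W $ i $ j *\<^sub>R xh k j) = (\<Sum>j\<in>UNIV. W $ i $ j *\<^sub>R xh k j)"
          by (intro sum.mono_neutral_left) auto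
        then show ?thesis using alg by (simp add: dmsgd_def)
      qed
      moreover have "xh k j = x k j - \<gamma> *\<^sub>R m (Suc k) j" for j
        using alg by (simp add: dmsgd_def)
      ultimately show ?thesis by (simp add: X_def M_def mix_def vec_eq_iff)
    qed
    have "X \<longlonglongrightarrow> F"
    proof (rule dmsgd_tendsto_fixed_point[OF beta gamma(1) step])
      show "mix W (F - (\<gamma> / (1 - \<beta>)) *\<^sub>R G F) = F" using F by (simp only: \<eta>_def)
    qed (fact M_step X_step)+
    then have "(\<lambda>k. (norm (X k - Z))\<^sup>2) \<longlonglongrightarrow> (norm (F - Z))\<^sup>2"
      by (intro tendsto_intros)
    moreover have "(norm (X k - Z))\<^sup>2 = (\<Sum>i\<in>UNIV. (norm (x k i - xstar))\<^sup>2)" for k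
      by (simp add: norm_vec_sq X_def Z_def)
    ultimately have lim: "(\<lambda>k. \<Sum>i\<in>UNIV. (norm (x k i - xstar))\<^sup>2) \<longlonglongrightarrow> (norm (F - Z))\<^sup>2"
      by simp
    have Z: "avg Z = Z" by (simp only: Z_def avg_const)
    have "(\<Sum>i\<in>UNIV. grad (f i) xstar) = 0"
      using f(1) min by (intro sum_grad_at_minimizer) (auto simp: L_smooth_def)
    then have GZ: "avg (G Z) = 0"
      by (simp add: avg_eq_0_iff G_def stacked_grad_def Z_def)
    have "(norm (F - Z))\<^sup>2 \<le> ((1 + L' / \<mu>) * (2 * \<eta> / (1 - \<rho>)) * norm (G Z))\<^sup>2"
      by (intro power_mono fixed_point_bias F eta bounds Z GZ) simp
    also have "\<dots> = (1 + L' / \<mu>)\<^sup>2 * (4 * \<gamma>\<^sup>2 / ((1 - \<beta>)\<^sup>2 * (1 - \<rho>)\<^sup>2)) * (norm (G Z))\<^sup>2"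
      by (simp add: \<eta>_def power_mult_distrib power_divide)
    also have "(norm (G Z))\<^sup>2 = real CARD('n) * data_inconsistency_sq f xstar"
      by (simp add: norm_vec_sq G_def stacked_grad_def Z_def data_inconsistency_sq_def)
    also have "(1 + L' / \<mu>)\<^sup>2 * (4 * \<gamma>\<^sup>2 / ((1 - \<beta>)\<^sup>2 * (1 - \<rho>)\<^sup>2)) * (real CARD('n) * data_inconsistency_sq f xstar)
        = C * (\<gamma>\<^sup>2 * data_inconsistency_sq f xstar / ((1 - \<beta>)\<^sup>2 * (1 - \<rho>)\<^sup>2))"
      by (simp add: C_def)
    finally show ?thesis using lim by blast
  qed
  \<comment> \<open>The threshold is fixed before \<open>W\<close>, for arbitrary real
    \<open>\<rho>\<close>. The default 1 covers \<open>\<rho> \<ge> 1\<close>, which is the mixing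
    rate of no admissible \<open>W\<close>.\<close>
  have step: "0 < (if \<rho> < 1 then max_step L' \<mu> \<beta> \<rho> else 1)" if "0 < \<beta>" "\<beta> < 1" for \<beta> \<rho>
    using that max_step_pos[OF L'(2) assms(2)] by simp
  show ?thesis
  proof (rule exI[of _ C], intro conjI C allI impI, elim conjE)
    fix \<beta> \<rho> :: real
    assume beta: "0 < \<beta>" "\<beta> < 1"
    show "\<exists>\<gamma>0>0. \<forall>(E :: ('n \<times> 'n) set) (W :: real^'n^'n) (f :: 'n \<Rightarrow> real^'d \<Rightarrow> real) xstar \<gamma> x xh m.
      sym E \<and> strongly_connected E \<and>
      weights_of E W \<and> transpose W = W \<and> W *v 1 = 1 \<and> \<rho> = mixing_rate W \<and>
      (\<forall>i. L_smooth L (f i)) \<and> (\<forall>i. strongly_convex \<mu> (f i)) \<and>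
      global_minimizer (avg_objective f) xstar \<and>
      0 < \<gamma> \<and> \<gamma> \<le> \<gamma>0 \<and> dmsgd W f \<gamma> \<beta> x xh m \<longrightarrow>
      (\<exists>l. (\<lambda>k. \<Sum>i\<in>UNIV. (norm (x k i - xstar))\<^sup>2) \<longlonglongrightarrow> l \<and>
        l \<le> C * (\<gamma>\<^sup>2 * data_inconsistency_sq f xstar / ((1 - \<beta>)\<^sup>2 * (1 - \<rho>)\<^sup>2)))"
      by (rule exI[of _ "if \<rho> < 1 then max_step L' \<mu> \<beta> \<rho> else 1"], intro conjI step[OF beta] allI impI, elim conjE)
        (rule main[OF beta], auto)
  qed
qed

end
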